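(* Let $(\mathbf{u}_h^{n+1},P_h^{n+1})_{0\le n\le N-1}$ be a solution of the EMAC-FILTERED scheme, i.e. for $n=0,1,\dots,N-1$ and all $(\mathbf{v}_h,q_h)\in \mathbf{X}_h\times Q_h$, $$\frac{1}{\Delta t}\Big(\tfrac32\mathbf{u}_h^{n+1}-2\mathbf{u}_h^n+\tfrac12\mathbf{u}_h^{n-1},\mathbf{v}_h\Big)+\nu\big(\nabla F[\mathbf{u}_h^{n+1}],\nabla\mathbf{v}_h\big)+c\big(F[\mathbf{u}_h^{n+1}],F[\mathbf{u}_h^{n+1}],\mathbf{v}_h\big)-(P_h^{n+1},\nabla\cdot\mathbf{v}_h)=(\mathbf{f}(t^{n+1}),\mathbf{v}_h),$$ $$(\nabla\cdot F[\mathbf{u}_h^{n+1}],q_h)=0 .$$ Then $$\left\|\begin{bmatrix}\mathbf{u}_h^{N}\\ \mathbf{u}_h^{N-1}\end{bmatrix}\right\|_G^2+\Delta t\sum_{n=1}^{N-1}\nu\|\nabla F[\mathbf{u}_h^{n+1}]\|^2+\frac14\sum_{n=1}^{N-1}\|\mathbf{u}_h^{n+1}-2\mathbf{u}_h^n+\mathbf{u}_h^{n-1}\|_F^2=\left\|\begin{bmatrix}\mathbf{u}_h^{1}\\ \mathbf{u}_h^{0}\end{bmatrix}\right\|_G^2+\Delta t\sum_{n=1}^{N-1}(\mathbf{f}(t^{n+1}),F[\mathbf{u}_h^{n+1}]).$$ In particular, for $\nu=0$ and $\mathbf{f}=\mathbf{0}$ the scheme conserves a modified kinetic energy, in the sense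 that this identity holds with the $\nu$- and $\mathbf{f}$-terms absent.
   Context: Domain and spaces: $\Omega\subset\mathbb{R}^d$, $d\in\{2,3\}$, is a convex polygonal or polyhedral domain; $(\cdot,\cdot)$ and $\|\cdot\|$ are the $L^2(\Omega)$ inner product and norm; $\mathbf{X}=(H_0^1(\Omega))^d$, $Q=L_0^2(\Omega)$ (zero-mean $L^2$ functions). $\mathbf{X}_h\subset\mathbf{X}$, $Q_h\subset Q$ are finite element spaces on a regular conforming triangulation of $\Omega$ with maximal diameter $h$, satisfying the discrete inf-sup condition $\inf_{q_h\in Q_h}\sup_{\mathbf{v}_h\in\mathbf{X}_h}\frac{(q_h,\nabla\cdot\mathbf{v}_h)}{\|\nabla\mathbf{v}_h\|\,\|q_h\|}\ge\beta_0>0$. Data: $\nu$ is the kinematic viscosity, $\mathbf{f}$ the body force, $\mathbf{u}_0$ the initial velocity, $T$ the final time, $N$ the number of time steps, $\Delta t=T/N$, $t^n=n\Delta t$. $\mathbf{u}_h^0$ and $\mathbf{u}_h^{-1}$ are both the nodal interpolant of $\mathbf{u}_0$ in $\mathbf{X}_h$. Trilinear form (EMAC): $c(\mathbf{u},\mathbf{v},\mathbf{w})=2(\mathbb{D}(\mathbf{u})\mathbf{v},\mathbf{w})+((\nabla\cdot\mathbf{u})\mathbf{v},\mathbf{w})$ with $\mathbb{D}(\mathbf{u})=\frac12(\nabla\mathbf{u}+(\nabla\mathbf{u})^T)$. Time-filter operator: $F[\mathbf{w}^{n+1}]=\frac32\mathbf{w}^{n+1}-\mathbf{w}^n+\frac12\mathbf{w}^{n-1}$.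 (The scheme is equivalent to a backward Euler step for $\tilde{\mathbf{u}}_h^{n+1}=F[\mathbf{u}_h^{n+1}]$ followed by $\mathbf{u}_h^{n+1}=\tilde{\mathbf{u}}_h^{n+1}-\frac13(\tilde{\mathbf{u}}_h^{n+1}-2\mathbf{u}_h^n+\mathbf{u}_h^{n-1})$.) Norms: $G=\begin{pmatrix}3/2&-3/4\\-3/4&1/2\end{pmatrix}$ and $\left\|\begin{bmatrix}\mathbf{u}\\\mathbf{v}\end{bmatrix}\right\|_G^2=\left(\begin{bmatrix}\mathbf{u}\\\mathbf{v}\end{bmatrix},G\begin{bmatrix}\mathbf{u}\\\mathbf{v}\end{bmatrix}\right)=\frac32\|\mathbf{u}\|^2-\frac32(\mathbf{u},\mathbf{v})+\frac12\|\mathbf{v}\|^2$; and $\|\mathbf{u}\|_F^2=(\mathbf{u},3\mathbf{u})=3\|\mathbf{u}\|^2$ (i.e. with the matrix $F=3I$). *)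

theory Defs
  imports "HOL-Analysis.Analysis"
begin

section \<open>Square-integrable functions\<close>

text \<open>
  Elements of function spaces on \<open>\<Omega>\<close> are represented by functions on the whole of
  \<open>\<real>\<^sup>d = real^'d\<close>; only their values on \<open>\<Omega>\<close> (on its closure, for finite element velocities)
  carry meaning, and no identification of almost everywhere equal functions is made.
\<close>

definition L2 :: "(real^'d) set \<Rightarrow> ((real^'d) \<Rightarrow> 'b::euclidean_space) set" where
  "L2 \<Omega> = {u. u \<in> borel_measurable (lebesgue_on \<Omega>) \<and>
               integrable (lebesgue_on \<Omega>) (\<lambda>x. (norm (u x))\<^sup>2)}"

text \<open>For matrix-valued functions the pointwise inner product is the Frobenius one.\<close>

definition ip :: "(real^'d) set \<Rightarrow> ((real^'d) \<Rightarrow> 'b::euclidean_space) \<Rightarrow> ((real^'d) \<Rightarrow> 'b) \<Rightarrow> real" where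
  "ip \<Omega> u v = integral\<^sup>L (lebesgue_on \<Omega>) (\<lambda>x. u x \<bullet> v x)"

definition L2norm :: "(real^'d) set \<Rightarrow> ((real^'d) \<Rightarrow> 'b::euclidean_space) \<Rightarrow> real" where
  "L2norm \<Omega> u = sqrt (ip \<Omega> u u)"

definition L20 :: "(real^'d) set \<Rightarrow> ((real^'d) \<Rightarrow> real) set" where
  "L20 \<Omega> = {q \<in> L2 \<Omega>. integral\<^sup>L (lebesgue_on \<Omega>) q = 0}"


section \<open>Sobolev spaces\<close>

definition partial :: "'d \<Rightarrow> ((real^'d) \<Rightarrow> real) \<Rightarrow> (real^'d) \<Rightarrow> real" where
  "partial j \<phi> x = frechet_derivative \<phi> (at x) (axis j 1)"

definition grad :: "((real^'d) \<Rightarrow> real) \<Rightarrow> (real^'d) \<Rightarrow> real^'d" where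
  "grad \<phi> x = (\<chi> j. partial j \<phi> x)"

primrec Ck :: "nat \<Rightarrow> ((real^'d) \<Rightarrow> real) \<Rightarrow> bool" where
  "Ck 0 \<phi> \<longleftrightarrow> continuous_on UNIV \<phi>"
| "Ck (Suc k) \<phi> \<longleftrightarrow> (\<forall>x. \<phi> differentiable (at x)) \<and> (\<forall>j. Ck k (partial j \<phi>))"

text \<open>\<open>C\<^sub>c\<^sup>\<infinity>(\<Omega>)\<close>, each function being extended by zero.\<close>

definition test_functions :: "(real^'d) set \<Rightarrow> ((real^'d) \<Rightarrow> real) set" where
  "test_functions \<Omega> = {\<phi>. (\<forall>k. Ck k \<phi>) \<and> compact (closure {x. \<phi> x \<noteq> 0}) \<and>
                          closure {x. \<phi> x \<noteq> 0} \<subseteq> \<Omega>}"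

definition is_weak_grad :: "(real^'d) set \<Rightarrow> ((real^'d) \<Rightarrow> real) \<Rightarrow> ((real^'d) \<Rightarrow> real^'d) \<Rightarrow> bool" where
  "is_weak_grad \<Omega> u g \<longleftrightarrow> (\<forall>\<phi> \<in> test_functions \<Omega>. \<forall>j.
     integral\<^sup>L (lebesgue_on \<Omega>) (\<lambda>x. u x * partial j \<phi> x) =
     - integral\<^sup>L (lebesgue_on \<Omega>) (\<lambda>x. g x $ j * \<phi> x))"

definition H1 :: "(real^'d) set \<Rightarrow> ((real^'d) \<Rightarrow> real) set" where
  "H1 \<Omega> = {u \<in> L2 \<Omega>. \<exists>g \<in> L2 \<Omega>. is_weak_grad \<Omega> u g}"

text \<open>The weak gradient is unique up to null sets; \<open>wgrad\<close> picks a representative.\<close>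

definition wgrad :: "(real^'d) set \<Rightarrow> ((real^'d) \<Rightarrow> real) \<Rightarrow> (real^'d) \<Rightarrow> real^'d" where
  "wgrad \<Omega> u = (SOME g. g \<in> L2 \<Omega> \<and> is_weak_grad \<Omega> u g)"

text \<open>\<open>H\<^sub>0\<^sup>1(\<Omega>)\<close> is the closure of \<open>C\<^sub>c\<^sup>\<infinity>(\<Omega>)\<close> in the norm of \<open>H\<^sup>1(\<Omega>)\<close>.\<close>

definition H10 :: "(real^'d) set \<Rightarrow> ((real^'d) \<Rightarrow> real) set" where
  "H10 \<Omega> = {u \<in> H1 \<Omega>. \<exists>\<phi> :: nat \<Rightarrow> (real^'d) \<Rightarrow> real. (\<forall>k. \<phi> k \<in> test_functions \<Omega>) \<and>
     (\<lambda>k. L2norm \<Omega> (\<lambda>x. \<phi> k x - u x)) \<longlonglongrightarrow> 0 \<and>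
     (\<lambda>k. L2norm \<Omega> (\<lambda>x. grad (\<phi> k) x - wgrad \<Omega> u x)) \<longlonglongrightarrow> 0}"

definition H10_vec :: "(real^'d) set \<Rightarrow> ((real^'d) \<Rightarrow> real^'d) set" where
  "H10_vec \<Omega> = {v. \<forall>i. (\<lambda>x. v x $ i) \<in> H10 \<Omega>}"

text \<open>The \<open>(i,j)\<close> entry of \<open>Grad \<Omega> v\<close> is \<open>\<partial>\<^sub>j v\<^sub>i\<close>.\<close>

definition Grad :: "(real^'d) set \<Rightarrow> ((real^'d) \<Rightarrow> real^'d) \<Rightarrow> (real^'d) \<Rightarrow> real^'d^'d" where
  "Grad \<Omega> v x = (\<chi> i. wgrad \<Omega> (\<lambda>y. v y $ i) x)"

definition Div :: "(real^'d) set \<Rightarrow> ((real^'d) \<Rightarrow> real^'d) \<Rightarrow> (real^'d) \<Rightarrow> real" where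
  "Div \<Omega> v x = trace (Grad \<Omega> v x)"

definition sym_grad :: "(real^'d) set \<Rightarrow> ((real^'d) \<Rightarrow> real^'d) \<Rightarrow> (real^'d) \<Rightarrow> real^'d^'d" where
  "sym_grad \<Omega> v x = (1/2) *\<^sub>R (Grad \<Omega> v x + transpose (Grad \<Omega> v x))"

definition emac :: "(real^'d) set \<Rightarrow> ((real^'d) \<Rightarrow> real^'d) \<Rightarrow> ((real^'d) \<Rightarrow> real^'d) \<Rightarrow>
    ((real^'d) \<Rightarrow> real^'d) \<Rightarrow> real" where
  "emac \<Omega> u v w = 2 * ip \<Omega> (\<lambda>x. sym_grad \<Omega> u x *v v x) w + ip \<Omega> (\<lambda>x. Div \<Omega> u x *\<^sub>R v x) w"


section \<open>Domain, mesh and finite element spaces\<close>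

text \<open>A convex polygonal (\<open>d = 2\<close>) or polyhedral (\<open>d = 3\<close>) domain.\<close>

definition convex_polytopal_domain :: "(real^'d) set \<Rightarrow> bool" where
  "convex_polytopal_domain \<Omega> \<longleftrightarrow> open \<Omega> \<and> \<Omega> \<noteq> {} \<and> convex \<Omega> \<and> polytope (closure \<Omega>)"

definition inball_diameter :: "(real^'d) set \<Rightarrow> real" where
  "inball_diameter K = Sup {2 * r | r. 0 \<le> r \<and> (\<exists>x. cball x r \<subseteq> K)}"

text \<open>
  \<open>triangulation\<close> requires any two cells to meet in a common face, i.e. conformity;
  regularity is the bound \<open>h\<^sub>K \<le> \<sigma> \<rho>\<^sub>K\<close> on the shape of the cells.
\<close>

definition regular_mesh :: "(real^'d) set \<Rightarrow> real \<Rightarrow> real \<Rightarrow> (real^'d) set set \<Rightarrow> bool" where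
  "regular_mesh \<Omega> \<sigma> h \<T> \<longleftrightarrow>
     triangulation \<T> \<and> (\<forall>K\<in>\<T>. int CARD('d) simplex K) \<and> \<Union>\<T> = closure \<Omega> \<and>
     (\<forall>K\<in>\<T>. diameter K \<le> \<sigma> * inball_diameter K) \<and> h = Max (diameter ` \<T>)"

definition fin_span :: "nat \<Rightarrow> (nat \<Rightarrow> 'a \<Rightarrow> 'b::real_vector) \<Rightarrow> ('a \<Rightarrow> 'b) set" where
  "fin_span m \<phi> = {v. \<exists>c :: nat \<Rightarrow> real. v = (\<lambda>x. \<Sum>i<m. c i *\<^sub>R \<phi> i x)}"

text \<open>
  A conforming velocity space: finite-dimensional, contained in \<open>H\<^sub>0\<^sup>1(\<Omega>)\<^sup>d\<close>, with elements
  polynomial on each closed cell (and thereby continuous on the closure of \<open>\<Omega>\<close>). Pressures may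
  jump across cell boundaries, so they are only required to be polynomial on the open cells.
\<close>

definition fe_velocity_space :: "(real^'d) set \<Rightarrow> (real^'d) set set \<Rightarrow> ((real^'d) \<Rightarrow> real^'d) set \<Rightarrow> bool" where
  "fe_velocity_space \<Omega> \<T> X \<longleftrightarrow> (\<exists>m \<phi>. X = fin_span m \<phi>) \<and> X \<subseteq> H10_vec \<Omega> \<and>
     (\<forall>v\<in>X. \<forall>K\<in>\<T>. \<exists>p. polynomial_function p \<and> (\<forall>x\<in>K. v x = p x))"

definition fe_pressure_space :: "(real^'d) set \<Rightarrow> (real^'d) set set \<Rightarrow> ((real^'d) \<Rightarrow> real) set \<Rightarrow> bool" where
  "fe_pressure_space \<Omega> \<T> Q \<longleftrightarrow> (\<exists>m \<psi>. Q = fin_span m \<psi>) \<and> Q \<subseteq> L20 \<Omega> \<and>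
     (\<forall>q\<in>Q. \<forall>K\<in>\<T>. \<exists>p. polynomial_function p \<and> (\<forall>x\<in>interior K. q x = p x))"

text \<open>
  The extended reals make supremum and infimum meaningful without boundedness side conditions;
  the fractions themselves are real.
\<close>

definition discrete_inf_sup :: "(real^'d) set \<Rightarrow> ((real^'d) \<Rightarrow> real^'d) set \<Rightarrow> ((real^'d) \<Rightarrow> real) set \<Rightarrow>
    real \<Rightarrow> bool" where
  "discrete_inf_sup \<Omega> X Q \<beta>\<^sub>0 \<longleftrightarrow>
     (INF q \<in> {q\<in>Q. L2norm \<Omega> q \<noteq> 0}. SUP v \<in> {v\<in>X. L2norm \<Omega> (Grad \<Omega> v) \<noteq> 0}.
        ereal (ip \<Omega> q (Div \<Omega> v) / (L2norm \<Omega> (Grad \<Omega> v) * L2norm \<Omega> q))) \<ge> ereal \<beta>\<^sub>0"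

text \<open>
  A nodal basis of a vector-valued finite element space: the degrees of freedom are the
  components \<open>v (z i) \<bullet> a i\<close> at the nodes \<open>z i\<close> in the directions \<open>a i\<close>. For Lagrange elements
  every interior node occurs \<open>d\<close> times, once with each coordinate direction.
\<close>

definition nodal_basis :: "(real^'d) set \<Rightarrow> ((real^'d) \<Rightarrow> real^'d) set \<Rightarrow> nat \<Rightarrow>
    (nat \<Rightarrow> (real^'d) \<Rightarrow> real^'d) \<Rightarrow> (nat \<Rightarrow> real^'d) \<Rightarrow> (nat \<Rightarrow> real^'d) \<Rightarrow> bool" where
  "nodal_basis \<Omega> X m \<phi> z a \<longleftrightarrow> X = fin_span m \<phi> \<and> (\<forall>i<m. z i \<in> closure \<Omega>) \<and>
     (\<forall>i<m. \<forall>j<m. \<phi> j (z i) \<bullet> a i = (if i = j then 1 else 0))"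

definition nodal_interpolant :: "nat \<Rightarrow> (nat \<Rightarrow> (real^'d) \<Rightarrow> real^'d) \<Rightarrow> (nat \<Rightarrow> real^'d) \<Rightarrow>
    (nat \<Rightarrow> real^'d) \<Rightarrow> ((real^'d) \<Rightarrow> real^'d) \<Rightarrow> (real^'d) \<Rightarrow> real^'d" where
  "nodal_interpolant m \<phi> z a w x = (\<Sum>i<m. (w (z i) \<bullet> a i) *\<^sub>R \<phi> i x)"


section \<open>The time-filtered scheme\<close>

text \<open>Discrete functions of time are indexed by integers because of the starting value \<open>u (- 1)\<close>.\<close>

definition filt :: "(int \<Rightarrow> (real^'d) \<Rightarrow> real^'d) \<Rightarrow> int \<Rightarrow> (real^'d) \<Rightarrow> real^'d" where
  "filt w n x = (3/2) *\<^sub>R w n x - w (n - 1) x + (1/2) *\<^sub>R w (n - 2) x"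

definition G_mat :: "real^2^2" where
  "G_mat = vector [vector [3/2, -3/4], vector [-3/4, 1/2]]"

definition G_norm_sq :: "(real^'d) set \<Rightarrow> ((real^'d) \<Rightarrow> real^'d) \<Rightarrow> ((real^'d) \<Rightarrow> real^'d) \<Rightarrow> real" where
  "G_norm_sq \<Omega> u v =
     ip \<Omega> u (\<lambda>x. (G_mat $ 1 $ 1) *\<^sub>R u x + (G_mat $ 1 $ 2) *\<^sub>R v x) +
     ip \<Omega> v (\<lambda>x. (G_mat $ 2 $ 1) *\<^sub>R u x + (G_mat $ 2 $ 2) *\<^sub>R v x)"

definition F_norm_sq :: "(real^'d) set \<Rightarrow> ((real^'d) \<Rightarrow> real^'d) \<Rightarrow> real" where
  "F_norm_sq \<Omega> u = ip \<Omega> u (\<lambda>x. 3 *\<^sub>R u x)"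

definition emac_filtered_solution :: "(real^'d) set \<Rightarrow> ((real^'d) \<Rightarrow> real^'d) set \<Rightarrow>
    ((real^'d) \<Rightarrow> real) set \<Rightarrow> real \<Rightarrow> (real \<Rightarrow> (real^'d) \<Rightarrow> real^'d) \<Rightarrow> real \<Rightarrow> nat \<Rightarrow>
    (int \<Rightarrow> (real^'d) \<Rightarrow> real^'d) \<Rightarrow> (int \<Rightarrow> (real^'d) \<Rightarrow> real) \<Rightarrow> bool" where
  "emac_filtered_solution \<Omega> X Q \<nu> f \<Delta>t N u P \<longleftrightarrow>
     (\<forall>n\<in>{0..int N - 1}. u (n + 1) \<in> X \<and> P (n + 1) \<in> Q \<and>
        (\<forall>v\<in>X. \<forall>q\<in>Q.
          1 / \<Delta>t * ip \<Omega> (\<lambda>x. (3/2) *\<^sub>R u (n + 1) x - 2 *\<^sub>R u n x + (1/2) *\<^sub>R u (n - 1) x) v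
            + \<nu> * ip \<Omega> (Grad \<Omega> (filt u (n + 1))) (Grad \<Omega> v)
            + emac \<Omega> (filt u (n + 1)) (filt u (n + 1)) v
            - ip \<Omega> (P (n + 1)) (Div \<Omega> v)
          = ip \<Omega> (f (of_int (n + 1) * \<Delta>t)) v \<and>
          ip \<Omega> (Div \<Omega> (filt u (n + 1))) q = 0))"

end

theory Submission
  imports Defs
begin

text \<open>
  Testing the scheme with the filtered velocity \<open>w = F[u\<^sup>n\<^sup>+\<^sup>1]\<close> removes the pressure term, since \<open>w\<close>
  is discretely divergence-free, and the EMAC term, since pointwise
  \<open>2 D(w)w \<bullet> w + (div w) |w|\<^sup>2 = div (|w|\<^sup>2 w)\<close>. The integral of this divergence vanishes because
  \<open>w \<in> H\<^sub>0\<^sup>1\<close> is bounded, being piecewise polynomial: the integrated product rule for three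
  functions passes from test functions to bounded functions in \<open>H\<^sub>0\<^sup>1\<close>, one factor at a time.
  The time difference tested with \<open>w\<close> is a difference of \<open>G\<close>-norms plus a numerical
  dissipation, so the energy balance telescopes.
\<close>

section \<open>Square-integrable functions\<close>

lemma L2_measurable: "u \<in> L2 \<Omega> \<Longrightarrow> u \<in> borel_measurable (lebesgue_on \<Omega>)"
  by (simp add: L2_def)

lemma L2_inner_integrable:
  fixes u v :: "real^'d \<Rightarrow> 'b::euclidean_space"
  assumes "u \<in> L2 \<Omega>" "v \<in> L2 \<Omega>"
  shows "integrable (lebesgue_on \<Omega>) (\<lambda>x. u x \<bullet> v x)"
proof (rule Bochner_Integration.integrable_bound)
  show "integrable (lebesgue_on \<Omega>) (\<lambda>x. (norm (u x))\<^sup>2 + (norm (v x))\<^sup>2)"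
    using assms by (auto simp: L2_def)
  show "(\<lambda>x. u x \<bullet> v x) \<in> borel_measurable (lebesgue_on \<Omega>)"
    using assms[THEN L2_measurable] by measurable
  have "norm (u x \<bullet> v x) \<le> norm ((norm (u x))\<^sup>2 + (norm (v x))\<^sup>2)" for x
  proof -
    have "\<bar>u x \<bullet> v x\<bar> \<le> norm (u x) * norm (v x)"
      by (rule Cauchy_Schwarz_ineq2)
    also have "\<dots> \<le> 2 * (norm (u x) * norm (v x))"
      by simp
    also have "\<dots> \<le> (norm (u x))\<^sup>2 + (norm (v x))\<^sup>2"
      using sum_squares_bound[of "norm (u x)" "norm (v x)"] by simp
    finally show ?thesis by simp
  qed
  then show "AE x in lebesgue_on \<Omega>. norm (u x \<bullet> v x) \<le> norm ((norm (u x))\<^sup>2 + (norm (v x))\<^sup>2)"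
    by simp
qed

lemma L2_mult_integrable:
  fixes u v :: "real^'d \<Rightarrow> real"
  assumes "u \<in> L2 \<Omega>" "v \<in> L2 \<Omega>"
  shows "integrable (lebesgue_on \<Omega>) (\<lambda>x. u x * v x)"
  using L2_inner_integrable[OF assms] by simp

lemma L2_scaleR:
  assumes "u \<in> L2 \<Omega>"
  shows "(\<lambda>x. c *\<^sub>R u x) \<in> L2 \<Omega>"
  using assms by (auto simp: L2_def power_mult_distrib)

lemma L2_add:
  fixes u v :: "real^'d \<Rightarrow> 'b::euclidean_space"
  assumes "u \<in> L2 \<Omega>" "v \<in> L2 \<Omega>"
  shows "(\<lambda>x. u x + v x) \<in> L2 \<Omega>"
proof -
  have "integrable (lebesgue_on \<Omega>) (\<lambda>x. (norm (u x))\<^sup>2 + 2 * (u x \<bullet> v x) + (norm (v x))\<^sup>2)"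
    using assms L2_inner_integrable[OF assms] by (auto simp: L2_def)
  moreover have "(norm (u x + v x))\<^sup>2 = (norm (u x))\<^sup>2 + 2 * (u x \<bullet> v x) + (norm (v x))\<^sup>2" for x
    unfolding power2_norm_eq_inner by (simp add: algebra_simps inner_commute)
  ultimately show ?thesis
    using assms by (auto simp: L2_def)
qed

lemma L2_diff:
  fixes u v :: "real^'d \<Rightarrow> 'b::euclidean_space"
  assumes "u \<in> L2 \<Omega>" "v \<in> L2 \<Omega>"
  shows "(\<lambda>x. u x - v x) \<in> L2 \<Omega>"
  using L2_add[OF assms(1) L2_scaleR[OF assms(2), of "-1"]] by simp

lemma L2_norm_bound:
  assumes "u \<in> L2 \<Omega>" "v \<in> borel_measurable (lebesgue_on \<Omega>)" "\<And>x. x \<in> \<Omega> \<Longrightarrow> norm (v x) \<le> norm (u x)"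
    "\<Omega> \<in> sets lebesgue"
  shows "v \<in> L2 \<Omega>"
proof -
  have "integrable (lebesgue_on \<Omega>) (\<lambda>x. (norm (v x))\<^sup>2)"
  proof (rule Bochner_Integration.integrable_bound)
    show "integrable (lebesgue_on \<Omega>) (\<lambda>x. (norm (u x))\<^sup>2)"
      using assms by (auto simp: L2_def)
    show "AE x in lebesgue_on \<Omega>. norm ((norm (v x))\<^sup>2) \<le> norm ((norm (u x))\<^sup>2)"
      using assms by (intro AE_I2) (auto intro: power_mono)
  qed (use assms in measurable)
  with assms show ?thesis by (auto simp: L2_def)
qed

lemma L2_vec_nth:
  fixes u :: "real^'d \<Rightarrow> real^'n"
  assumes "u \<in> L2 \<Omega>" "\<Omega> \<in> sets lebesgue"
  shows "(\<lambda>x. u x $ i) \<in> L2 \<Omega>"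
proof (rule L2_norm_bound[OF assms(1)])
  show "(\<lambda>x. u x $ i) \<in> borel_measurable (lebesgue_on \<Omega>)"
    using borel_measurable_continuous_on[OF _ L2_measurable[OF assms(1)], of "\<lambda>y. y $ i"]
    by (simp add: continuous_on_component)
qed (use assms in \<open>auto simp: component_le_norm_cart\<close>)

lemma L2_vecI:
  fixes u :: "real^'d \<Rightarrow> real^'n"
  assumes "\<And>i. (\<lambda>x. u x $ i) \<in> L2 \<Omega>"
  shows "u \<in> L2 \<Omega>"
proof -
  have "u \<in> borel_measurable (lebesgue_on \<Omega>)"
    using assms by (subst borel_measurable_euclidean_space)
      (auto simp: Basis_vec_def inner_axis L2_def)
  moreover have "(norm (u x))\<^sup>2 = (\<Sum>i\<in>UNIV. (norm (u x $ i))\<^sup>2)" for x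
    unfolding power2_norm_eq_inner inner_vec_def by (rule refl)
  then have "integrable (lebesgue_on \<Omega>) (\<lambda>x. (norm (u x))\<^sup>2)"
    using assms by (auto simp: L2_def)
  ultimately show ?thesis by (auto simp: L2_def)
qed

text \<open>A product of two square-integrable functions is in general only integrable. One bounded
  factor keeps it in \<open>L2\<close>, so that it can still be paired with a third function; every
  trilinear term below is handled this way.\<close>

lemma L2_mult_bounded:
  fixes u v :: "real^'d \<Rightarrow> real"
  assumes "u \<in> L2 \<Omega>" "v \<in> borel_measurable (lebesgue_on \<Omega>)" "bounded (v ` \<Omega>)" "\<Omega> \<in> sets lebesgue"
  shows "(\<lambda>x. v x * u x) \<in> L2 \<Omega>"
proof -
  obtain B where B: "\<And>x. x \<in> \<Omega> \<Longrightarrow> norm (v x) \<le> B"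
    using assms(3) by (auto simp: bounded_iff)
  show ?thesis
  proof (rule L2_norm_bound[OF L2_scaleR[OF assms(1), of B]])
    show "(\<lambda>x. v x * u x) \<in> borel_measurable (lebesgue_on \<Omega>)"
      using assms(1,2) L2_measurable by measurable
    show "norm (v x * u x) \<le> norm (B *\<^sub>R u x)" if "x \<in> \<Omega>" for x
      using B[OF that] by (auto simp: abs_mult intro!: mult_right_mono)
  qed fact
qed

text \<open>A bounded open set has finite measure, so the constant 1 lies in \<open>L2\<close> and
  \<open>u\<close> is a bounded multiple of it.\<close>

lemma L2_bounded:
  fixes u :: "real^'d \<Rightarrow> real"
  assumes "u \<in> borel_measurable (lebesgue_on \<Omega>)" "bounded (u ` \<Omega>)" "open \<Omega>" "bounded \<Omega>"
  shows "u \<in> L2 \<Omega>"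
proof -
  have "\<Omega> \<in> lmeasurable"
    using assms bounded_set_imp_lmeasurable[of \<Omega>] by auto
  then interpret finite_measure "lebesgue_on \<Omega>"
    by (rule finite_measure_lebesgue_on)
  have "(\<lambda>x. 1) \<in> L2 \<Omega>"
    by (simp add: L2_def)
  from L2_mult_bounded[OF this assms(1,2)] show ?thesis
    using assms by simp
qed

section \<open>The \<open>L2\<close> inner product: bilinearity, Cauchy-Schwarz and
  continuity\<close>

lemma ip_commute: "ip \<Omega> u v = ip \<Omega> v u"
  by (simp add: ip_def inner_commute)

lemma ip_add_right:
  assumes "u \<in> L2 \<Omega>" "v \<in> L2 \<Omega>" "w \<in> L2 \<Omega>"
  shows "ip \<Omega> u (\<lambda>x. v x + w x) = ip \<Omega> u v + ip \<Omega> u w"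
  using assms by (simp add: ip_def inner_add_right L2_inner_integrable)

lemma ip_scaleR_right: "ip \<Omega> u (\<lambda>x. c *\<^sub>R v x) = c * ip \<Omega> u v"
  by (simp add: ip_def)

lemma ip_diff_right:
  assumes "u \<in> L2 \<Omega>" "v \<in> L2 \<Omega>" "w \<in> L2 \<Omega>"
  shows "ip \<Omega> u (\<lambda>x. v x - w x) = ip \<Omega> u v - ip \<Omega> u w"
  using assms by (simp add: ip_def inner_diff_right L2_inner_integrable)

lemma ip_self_nonneg: "ip \<Omega> u u \<ge> 0"
  by (simp add: ip_def)

text \<open>Without identification of a.e. equal functions, \<open>ip\<close> is only positive
  semidefinite. The proof expands the nonnegative square of \<open>u - t v\<close> as a quadratic
  polynomial in \<open>t\<close>, and treats a null \<open>v\<close> separately.\<close>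

lemma ip_Cauchy_Schwarz:
  fixes u v :: "real^'d \<Rightarrow> 'b::euclidean_space"
  assumes "u \<in> L2 \<Omega>" "v \<in> L2 \<Omega>"
  shows "\<bar>ip \<Omega> u v\<bar> \<le> L2norm \<Omega> u * L2norm \<Omega> v"
proof -
  have expand: "ip \<Omega> (\<lambda>x. u x - t *\<^sub>R v x) (\<lambda>x. u x - t *\<^sub>R v x)
      = ip \<Omega> u u - 2 * t * ip \<Omega> u v + t\<^sup>2 * ip \<Omega> v v" for t
  proof -
    let ?w = "\<lambda>x. u x - t *\<^sub>R v x"
    have w: "ip \<Omega> z ?w = ip \<Omega> z u - t * ip \<Omega> z v" if "z \<in> L2 \<Omega>" for z
      using assms that by (simp add: ip_diff_right ip_scaleR_right L2_scaleR)
    have "?w \<in> L2 \<Omega>"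
      using assms by (intro L2_diff L2_scaleR)
    then have "ip \<Omega> ?w ?w = ip \<Omega> u ?w - t * ip \<Omega> v ?w"
      using w[of ?w] by (simp add: ip_commute)
    also have "\<dots> = ip \<Omega> u u - 2 * t * ip \<Omega> u v + t\<^sup>2 * ip \<Omega> v v"
      using assms by (simp add: w ip_commute[of \<Omega> v u] power2_eq_square algebra_simps)
    finally show ?thesis .
  qed
  have quad: "0 \<le> ip \<Omega> u u - 2 * t * ip \<Omega> u v + t\<^sup>2 * ip \<Omega> v v" for t
    unfolding expand[symmetric] by (rule ip_self_nonneg)
  have "(ip \<Omega> u v)\<^sup>2 \<le> ip \<Omega> u u * ip \<Omega> v v"
  proof (cases "ip \<Omega> v v = 0")
    case True
    \<comment> \<open>A nonnegative integrand with integral zero vanishes a.e., hence so does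
      \<open>v\<close>, and with it the product of \<open>u\<close> and \<open>v\<close>.\<close>
    have "AE x in lebesgue_on \<Omega>. v x \<bullet> v x = 0"
      using True assms L2_inner_integrable[of v \<Omega> v]
      by (subst (asm) ip_def) (subst (asm) integral_nonneg_eq_0_iff_AE; simp)
    then have "AE x in lebesgue_on \<Omega>. u x \<bullet> v x = 0"
      by eventually_elim simp
    then show ?thesis
      using True by (simp add: ip_def integral_eq_zero_AE)
  next
    case False
    then have pos: "ip \<Omega> v v > 0"
      using ip_self_nonneg[of \<Omega> v] by linarith
    then show ?thesis
      \<comment> \<open>This \<open>t\<close> minimises the quadratic polynomial.\<close>
      using quad[of "ip \<Omega> u v / ip \<Omega> v v"] by (simp add: field_simps power2_eq_square)
  qed
  then have "sqrt ((ip \<Omega> u v)\<^sup>2) \<le> sqrt (ip \<Omega> u u * ip \<Omega> v v)"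
    by (rule real_sqrt_le_mono)
  then show ?thesis
    by (simp add: L2norm_def real_sqrt_mult)
qed

text \<open>Cauchy-Schwarz bounds the error by the norm of \<open>u\<close> times the norm of
  \<open>w k - v\<close>. All later limit passages use this: one slot is held fixed while the
  approximating test functions occupy the other.\<close>

lemma ip_tendsto:
  fixes u v :: "real^'d \<Rightarrow> 'b::euclidean_space"
  assumes "u \<in> L2 \<Omega>" "v \<in> L2 \<Omega>" "\<And>k. w k \<in> L2 \<Omega>"
    and "(\<lambda>k. L2norm \<Omega> (\<lambda>x. w k x - v x)) \<longlonglongrightarrow> 0"
  shows "(\<lambda>k. ip \<Omega> u (w k)) \<longlonglongrightarrow> ip \<Omega> u v"
proof (rule LIM_zero_cancel, rule tendsto_rabs_zero_cancel, rule tendsto_sandwich[OF _ _ tendsto_const])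
  show "(\<lambda>k. L2norm \<Omega> u * L2norm \<Omega> (\<lambda>x. w k x - v x)) \<longlonglongrightarrow> 0"
    using tendsto_mult_right_zero[OF assms(4)] .
  show "\<forall>\<^sub>F k in sequentially. \<bar>ip \<Omega> u (w k) - ip \<Omega> u v\<bar> \<le> L2norm \<Omega> u * L2norm \<Omega> (\<lambda>x. w k x - v x)"
    using ip_Cauchy_Schwarz[OF assms(1) L2_diff[OF assms(3,2)]] assms
    by (simp add: ip_diff_right)
qed simp

lemma L2norm_mono:
  assumes "u \<in> L2 \<Omega>" "v \<in> L2 \<Omega>" "\<And>x. norm (v x) \<le> norm (u x)"
  shows "L2norm \<Omega> v \<le> L2norm \<Omega> u"
proof -
  have "ip \<Omega> v v \<le> ip \<Omega> u u"
    unfolding ip_def using assms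
    by (intro integral_mono L2_inner_integrable) (simp_all flip: norm_le)
  then show ?thesis
    by (simp add: L2norm_def)
qed

section \<open>Test functions\<close>

lemma Ck_Suc_imp_Ck: "Ck (Suc k) \<phi> \<Longrightarrow> Ck k \<phi>"
proof (induction k arbitrary: \<phi>)
  case 0
  then show ?case
    by (auto simp: continuous_on_eq_continuous_at differentiable_imp_continuous_within)
next
  case (Suc k)
  then show ?case by auto
qed

lemma partial_add:
  assumes "\<phi> differentiable (at x)" "\<psi> differentiable (at x)"
  shows "partial j (\<lambda>x. \<phi> x + \<psi> x) x = partial j \<phi> x + partial j \<psi> x"
  unfolding partial_def
  by (subst frechet_derivative_at[OF has_derivative_add[OF assms[unfolded frechet_derivative_works]], symmetric])
    (rule refl)

lemma partial_mult:
  assumes "\<phi> differentiable (at x)" "\<psi> differentiable (at x)"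
  shows "partial j (\<lambda>x. \<phi> x * \<psi> x) x = \<phi> x * partial j \<psi> x + partial j \<phi> x * \<psi> x"
  unfolding partial_def
  by (subst frechet_derivative_at[OF has_derivative_mult[OF assms[unfolded frechet_derivative_works]], symmetric])
    (rule refl)

lemma Ck_add: "Ck k \<phi> \<Longrightarrow> Ck k \<psi> \<Longrightarrow> Ck k (\<lambda>x. \<phi> x + \<psi> x)"
proof (induction k arbitrary: \<phi> \<psi>)
  case (Suc k)
  then have "partial j (\<lambda>x. \<phi> x + \<psi> x) = (\<lambda>x. partial j \<phi> x + partial j \<psi> x)" for j
    by (auto simp: partial_add)
  with Suc show ?case by auto
qed (auto intro: continuous_on_add)

text \<open>By Leibniz, each partial derivative is a sum of products of a factor with a derivative
  of the other; the undifferentiated factor is first lowered from class \<open>Suc k\<close> to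
  class \<open>k\<close>, so that the induction hypothesis applies.\<close>

lemma Ck_mult: "Ck k \<phi> \<Longrightarrow> Ck k \<psi> \<Longrightarrow> Ck k (\<lambda>x. \<phi> x * \<psi> x)"
proof (induction k arbitrary: \<phi> \<psi>)
  case (Suc k)
  then have "partial j (\<lambda>x. \<phi> x * \<psi> x) = (\<lambda>x. \<phi> x * partial j \<psi> x + partial j \<phi> x * \<psi> x)" for j
    by (auto simp: partial_mult)
  with Suc Ck_Suc_imp_Ck[of k \<phi>] Ck_Suc_imp_Ck[of k \<psi>] show ?case
    by (auto intro!: Ck_add)
qed (auto intro: continuous_on_mult)

lemma test_functions_differentiable:
  assumes "\<phi> \<in> test_functions \<Omega>"
  shows "\<phi> differentiable (at x)"
proof -
  have "Ck (Suc 0) \<phi>"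
    using assms unfolding test_functions_def by blast
  then show ?thesis by simp
qed

text \<open>The support of the product lies in that of the first factor. This makes a product of two
  test functions admissible in the definition of a weak gradient.\<close>

lemma test_functions_mult:
  assumes "\<phi> \<in> test_functions \<Omega>" "\<psi> \<in> test_functions \<Omega>"
  shows "(\<lambda>x. \<phi> x * \<psi> x) \<in> test_functions \<Omega>"
proof -
  have "closure {x. \<phi> x * \<psi> x \<noteq> 0} \<subseteq> closure {x. \<phi> x \<noteq> 0}"
    by (rule closure_mono) auto
  moreover have "compact (closure {x. \<phi> x * \<psi> x \<noteq> 0})"
  proof -
    have "bounded {x. \<phi> x \<noteq> 0}"
      using assms(1) by (simp add: test_functions_def compact_closure)
    then have "bounded {x. \<phi> x * \<psi> x \<noteq> 0}"
      by (rule bounded_subset) auto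
    then show ?thesis
      by (simp only: compact_closure)
  qed
  moreover have "closure {x. \<phi> x \<noteq> 0} \<subseteq> \<Omega>" "\<forall>k. Ck k \<phi>" "\<forall>k. Ck k \<psi>"
    using assms unfolding test_functions_def by blast+
  ultimately show ?thesis
    unfolding test_functions_def using Ck_mult by blast
qed

section \<open>Test functions and their derivatives as bounded elements of \<open>L2\<close>\<close>

lemma continuous_measurable_bounded:
  fixes \<phi> :: "real^'d \<Rightarrow> real"
  assumes "continuous_on UNIV \<phi>" "open \<Omega>" "bounded \<Omega>"
  shows "\<phi> \<in> borel_measurable (lebesgue_on \<Omega>)" "bounded (\<phi> ` \<Omega>)"
proof -
  show "\<phi> \<in> borel_measurable (lebesgue_on \<Omega>)"
    using assms by (intro continuous_imp_measurable_on_sets_lebesgue) (auto intro: continuous_on_subset)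
  have "bounded (\<phi> ` closure \<Omega>)"
    using assms by (intro compact_imp_bounded compact_continuous_image)
      (auto intro: continuous_on_subset simp: compact_closure)
  then show "bounded (\<phi> ` \<Omega>)"
    by (rule bounded_subset) (auto intro: subsetD[OF closure_subset])
qed

lemma test_functions_continuous:
  assumes "\<phi> \<in> test_functions \<Omega>"
  shows "continuous_on UNIV \<phi>" "continuous_on UNIV (partial j \<phi>)"
proof -
  have "Ck 0 \<phi>" "Ck (Suc 0) \<phi>"
    using assms unfolding test_functions_def by blast+
  then show "continuous_on UNIV \<phi>" "continuous_on UNIV (partial j \<phi>)"
    by auto
qed

text \<open>Facts 1 and 2 concern the test function itself, facts 3 and 4 its partial derivatives;
  citations below select by these positions.\<close>

lemmas test_functions_bounded =
  continuous_measurable_bounded[OF test_functions_continuous(1)]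
  continuous_measurable_bounded[OF test_functions_continuous(2)]

lemma test_functions_L2:
  assumes "\<phi> \<in> test_functions \<Omega>" "open \<Omega>" "bounded \<Omega>"
  shows "\<phi> \<in> L2 \<Omega>" "partial j \<phi> \<in> L2 \<Omega>"
  by (rule L2_bounded[OF test_functions_bounded(1,2)[OF assms] assms(2,3)],
      rule L2_bounded[OF test_functions_bounded(3,4)[OF assms] assms(2,3)])

section \<open>The product rule in \<open>H\<^sub>0\<^sup>1\<close>\<close>

lemma wgrad_works:
  assumes "u \<in> H1 \<Omega>"
  shows "wgrad \<Omega> u \<in> L2 \<Omega>" "is_weak_grad \<Omega> u (wgrad \<Omega> u)"
proof -
  have "wgrad \<Omega> u \<in> L2 \<Omega> \<and> is_weak_grad \<Omega> u (wgrad \<Omega> u)"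
    using assms someI_ex[of "\<lambda>g. g \<in> L2 \<Omega> \<and> is_weak_grad \<Omega> u g"]
    unfolding wgrad_def H1_def by blast
  then show "wgrad \<Omega> u \<in> L2 \<Omega>" "is_weak_grad \<Omega> u (wgrad \<Omega> u)" by auto
qed

lemma H10_L2:
  assumes "u \<in> H10 \<Omega>"
  shows "u \<in> L2 \<Omega>" "wgrad \<Omega> u \<in> L2 \<Omega>"
  using assms wgrad_works by (auto simp: H10_def H1_def)

text \<open>The definition of \<open>H10\<close> controls the whole gradient, while the product rule
  works with one direction \<open>j\<close> at a time; a component is dominated by the norm of the
  vector.\<close>

lemma H10_approx:
  assumes "u \<in> H10 \<Omega>" "open \<Omega>" "bounded \<Omega>"
  obtains \<phi> where "\<And>k::nat. \<phi> k \<in> test_functions \<Omega>"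
    "(\<lambda>k. L2norm \<Omega> (\<lambda>x. \<phi> k x - u x)) \<longlonglongrightarrow> 0"
    "\<And>j. (\<lambda>k. L2norm \<Omega> (\<lambda>x. partial j (\<phi> k) x - wgrad \<Omega> u x $ j)) \<longlonglongrightarrow> 0"
proof -
  obtain \<phi> :: "nat \<Rightarrow> real^'a \<Rightarrow> real" where \<phi>: "\<And>k. \<phi> k \<in> test_functions \<Omega>"
    "(\<lambda>k. L2norm \<Omega> (\<lambda>x. \<phi> k x - u x)) \<longlonglongrightarrow> 0"
    "(\<lambda>k. L2norm \<Omega> (\<lambda>x. grad (\<phi> k) x - wgrad \<Omega> u x)) \<longlonglongrightarrow> 0"
    using assms(1) unfolding H10_def by blast
  have \<Omega>: "\<Omega> \<in> sets lebesgue" using assms by auto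
  have wL2: "wgrad \<Omega> u \<in> L2 \<Omega>"
    using assms H10_L2 by auto
  have gL2: "(\<lambda>x. grad (\<phi> k) x - wgrad \<Omega> u x) \<in> L2 \<Omega>" for k
    using test_functions_L2(2)[OF \<phi>(1) assms(2,3)]
    by (intro L2_diff[OF _ wL2] L2_vecI) (simp add: grad_def)
  have "(\<lambda>k. L2norm \<Omega> (\<lambda>x. partial j (\<phi> k) x - wgrad \<Omega> u x $ j)) \<longlonglongrightarrow> 0" for j
  proof (rule tendsto_sandwich[OF _ _ tendsto_const \<phi>(3)])
    have "L2norm \<Omega> (\<lambda>x. partial j (\<phi> k) x - wgrad \<Omega> u x $ j)
        \<le> L2norm \<Omega> (\<lambda>x. grad (\<phi> k) x - wgrad \<Omega> u x)" for k
    proof (rule L2norm_mono[OF gL2])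
      show "(\<lambda>x. partial j (\<phi> k) x - wgrad \<Omega> u x $ j) \<in> L2 \<Omega>"
        using L2_vec_nth[OF gL2 \<Omega>, of k j] by (simp add: grad_def)
      show "norm (partial j (\<phi> k) x - wgrad \<Omega> u x $ j) \<le> norm (grad (\<phi> k) x - wgrad \<Omega> u x)" for x
        using component_le_norm_cart[of "grad (\<phi> k) x - wgrad \<Omega> u x" j] by (simp add: grad_def)
    qed
    then show "\<forall>\<^sub>F k in sequentially. L2norm \<Omega> (\<lambda>x. partial j (\<phi> k) x - wgrad \<Omega> u x $ j)
        \<le> L2norm \<Omega> (\<lambda>x. grad (\<phi> k) x - wgrad \<Omega> u x)"
      by simp
  qed (simp add: L2norm_def ip_self_nonneg)
  with \<phi> that show ?thesis by blast
qed

text \<open>The weak gradient of \<open>c\<close> is tested with the product of the two test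
  functions and Leibniz is applied. Each term keeps \<open>\<psi>\<close> or its derivative alone in
  the second slot, ready for \<open>ip_tendsto\<close>.\<close>

lemma weak_product_rule_test_test:
  assumes "\<phi> \<in> test_functions \<Omega>" "\<psi> \<in> test_functions \<Omega>" "c \<in> H1 \<Omega>" "open \<Omega>" "bounded \<Omega>"
  shows "ip \<Omega> (\<lambda>x. partial j \<phi> x * c x) \<psi> + ip \<Omega> (\<lambda>x. \<phi> x * c x) (partial j \<psi>)
    + ip \<Omega> (\<lambda>x. \<phi> x * wgrad \<Omega> c x $ j) \<psi> = 0"
proof -
  have \<Omega>: "\<Omega> \<in> sets lebesgue" using assms by auto
  have c: "c \<in> L2 \<Omega>" using assms by (simp add: H1_def)
  note \<phi> = test_functions_bounded[OF assms(1,4,5)]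
  note \<psi> = test_functions_L2[OF assms(2,4,5)]
  have int: "integrable (lebesgue_on \<Omega>) (\<lambda>x. (partial j \<phi> x * c x) * \<psi> x)"
      "integrable (lebesgue_on \<Omega>) (\<lambda>x. (\<phi> x * c x) * partial j \<psi> x)"
    using L2_mult_bounded[OF c \<phi>(1,2) \<Omega>] L2_mult_bounded[OF c \<phi>(3,4) \<Omega>] \<psi>
    by (auto intro!: L2_mult_integrable)
  have "integral\<^sup>L (lebesgue_on \<Omega>) (\<lambda>x. c x * partial j (\<lambda>x. \<phi> x * \<psi> x) x)
      = - integral\<^sup>L (lebesgue_on \<Omega>) (\<lambda>x. wgrad \<Omega> c x $ j * (\<phi> x * \<psi> x))"
    using wgrad_works(2)[OF assms(3)] test_functions_mult[OF assms(1,2)]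
    unfolding is_weak_grad_def by blast
  moreover have "(\<lambda>x. c x * partial j (\<lambda>x. \<phi> x * \<psi> x) x)
      = (\<lambda>x. (partial j \<phi> x * c x) * \<psi> x + (\<phi> x * c x) * partial j \<psi> x)"
    using assms(1,2)[THEN test_functions_differentiable]
    by (auto simp: partial_mult algebra_simps)
  ultimately show ?thesis
    using int by (simp add: ip_def mult_ac)
qed

text \<open>The second test function is replaced by \<open>b\<close> through approximation. The
  first slots are fixed elements of \<open>L2\<close>, because \<open>\<phi>\<close> and its
  derivatives are bounded.\<close>

lemma weak_product_rule_test:
  assumes "\<phi> \<in> test_functions \<Omega>" "b \<in> H10 \<Omega>" "c \<in> H1 \<Omega>" "open \<Omega>" "bounded \<Omega>"
  shows "ip \<Omega> (\<lambda>x. partial j \<phi> x * c x) b + ip \<Omega> (\<lambda>x. \<phi> x * c x) (\<lambda>x. wgrad \<Omega> b x $ j)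
    + ip \<Omega> (\<lambda>x. \<phi> x * wgrad \<Omega> c x $ j) b = 0"
proof -
  have \<Omega>: "\<Omega> \<in> sets lebesgue" using assms by auto
  have c: "c \<in> L2 \<Omega>" using assms by (simp add: H1_def)
  note b = H10_L2[OF assms(2)]
  note b' = L2_vec_nth[OF b(2) \<Omega>, of j]
  note c' = L2_vec_nth[OF wgrad_works(1)[OF assms(3)] \<Omega>, of j]
  note \<phi> = test_functions_bounded[OF assms(1,4,5)]
  obtain \<psi> where \<psi>: "\<And>k::nat. \<psi> k \<in> test_functions \<Omega>"
    "(\<lambda>k. L2norm \<Omega> (\<lambda>x. \<psi> k x - b x)) \<longlonglongrightarrow> 0"
    "\<And>j. (\<lambda>k. L2norm \<Omega> (\<lambda>x. partial j (\<psi> k) x - wgrad \<Omega> b x $ j)) \<longlonglongrightarrow> 0"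
    using H10_approx[OF assms(2,4,5)] by blast
  note \<psi>L2 = test_functions_L2[OF \<psi>(1) assms(4,5)]
  have "(\<lambda>k. ip \<Omega> (\<lambda>x. partial j \<phi> x * c x) (\<psi> k) + ip \<Omega> (\<lambda>x. \<phi> x * c x) (partial j (\<psi> k))
    + ip \<Omega> (\<lambda>x. \<phi> x * wgrad \<Omega> c x $ j) (\<psi> k)) \<longlonglongrightarrow>
    ip \<Omega> (\<lambda>x. partial j \<phi> x * c x) b + ip \<Omega> (\<lambda>x. \<phi> x * c x) (\<lambda>x. wgrad \<Omega> b x $ j)
    + ip \<Omega> (\<lambda>x. \<phi> x * wgrad \<Omega> c x $ j) b"
    using \<psi>L2 \<psi>(2,3) by (intro tendsto_add ip_tendsto[OF L2_mult_bounded[OF c \<phi>(3,4) \<Omega>] b(1)]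
        ip_tendsto[OF L2_mult_bounded[OF c \<phi>(1,2) \<Omega>] b']
        ip_tendsto[OF L2_mult_bounded[OF c' \<phi>(1,2) \<Omega>] b(1)])
  then show ?thesis
    using weak_product_rule_test_test[OF assms(1) \<psi>(1) assms(3-5)]
    by (simp add: LIMSEQ_const_iff)
qed

text \<open>The remaining test function is replaced by \<open>a\<close>. Its coefficients are now
  \<open>b c\<close>, \<open>c\<close> times a derivative of \<open>b\<close>, and \<open>b\<close>
  times a derivative of \<open>c\<close>; boundedness of \<open>b\<close> and \<open>c\<close> puts
  them in \<open>L2\<close>.\<close>

lemma weak_product_rule:
  assumes "a \<in> H10 \<Omega>" "b \<in> H10 \<Omega>" "c \<in> H10 \<Omega>" "bounded (b ` \<Omega>)" "bounded (c ` \<Omega>)"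
    "open \<Omega>" "bounded \<Omega>"
  shows "integral\<^sup>L (lebesgue_on \<Omega>) (\<lambda>x. b x * c x * wgrad \<Omega> a x $ j)
    + integral\<^sup>L (lebesgue_on \<Omega>) (\<lambda>x. c x * wgrad \<Omega> b x $ j * a x)
    + integral\<^sup>L (lebesgue_on \<Omega>) (\<lambda>x. b x * wgrad \<Omega> c x $ j * a x) = 0"
proof -
  have \<Omega>: "\<Omega> \<in> sets lebesgue" using assms by auto
  note a = H10_L2[OF assms(1)] and b = H10_L2[OF assms(2)] and c = H10_L2[OF assms(3)]
  note a' = L2_vec_nth[OF a(2) \<Omega>, of j] and b' = L2_vec_nth[OF b(2) \<Omega>, of j]
    and c' = L2_vec_nth[OF c(2) \<Omega>, of j]
  have cH1: "c \<in> H1 \<Omega>" using assms(3) by (simp add: H10_def)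
  obtain \<psi> where \<psi>: "\<And>k::nat. \<psi> k \<in> test_functions \<Omega>"
    "(\<lambda>k. L2norm \<Omega> (\<lambda>x. \<psi> k x - a x)) \<longlonglongrightarrow> 0"
    "\<And>j. (\<lambda>k. L2norm \<Omega> (\<lambda>x. partial j (\<psi> k) x - wgrad \<Omega> a x $ j)) \<longlonglongrightarrow> 0"
    using H10_approx[OF assms(1,6,7)] by blast
  note \<psi>L2 = test_functions_L2[OF \<psi>(1) assms(6,7)]
  have "(\<lambda>k. ip \<Omega> (\<lambda>x. b x * c x) (partial j (\<psi> k)) + ip \<Omega> (\<lambda>x. c x * wgrad \<Omega> b x $ j) (\<psi> k)
    + ip \<Omega> (\<lambda>x. b x * wgrad \<Omega> c x $ j) (\<psi> k)) \<longlonglongrightarrow>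
    ip \<Omega> (\<lambda>x. b x * c x) (\<lambda>x. wgrad \<Omega> a x $ j) + ip \<Omega> (\<lambda>x. c x * wgrad \<Omega> b x $ j) a
    + ip \<Omega> (\<lambda>x. b x * wgrad \<Omega> c x $ j) a" (is "?s \<longlonglongrightarrow> _")
    using \<psi>L2 \<psi>(2,3)
    by (intro tendsto_add
        ip_tendsto[OF L2_mult_bounded[OF c(1) L2_measurable[OF b(1)] assms(4) \<Omega>] a']
        ip_tendsto[OF L2_mult_bounded[OF b' L2_measurable[OF c(1)] assms(5) \<Omega>] a(1)]
        ip_tendsto[OF L2_mult_bounded[OF c' L2_measurable[OF b(1)] assms(4) \<Omega>] a(1)])
  \<comment> \<open>Up to reordering of factors, each member of the sequence is the previous lemma
    applied to \<open>\<psi> k\<close>.\<close>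
  moreover have "?s = (\<lambda>k. 0)"
    using weak_product_rule_test[OF \<psi>(1) assms(2) cH1 assms(6,7)]
    by (simp add: ip_def mult_ac)
  ultimately show ?thesis
    by (simp add: LIMSEQ_const_iff ip_def)
qed

text \<open>In components, the integrand is the sum over \<open>i\<close>, \<open>j\<close> of the
  \<open>j\<close>-th derivatives of \<open>v i * v i * v j\<close>, and each of these integrates to
  zero by the product rule.\<close>

lemma emac_self_eq_0:
  assumes "w \<in> H10_vec \<Omega>" "bounded (w ` \<Omega>)" "open \<Omega>" "bounded \<Omega>"
  shows "emac \<Omega> w w w = 0"
proof -
  have \<Omega>: "\<Omega> \<in> sets lebesgue" using assms by auto
  define v where "v i = (\<lambda>x. w x $ i)" for i
  define g where "g i j = (\<lambda>x. wgrad \<Omega> (v i) x $ j)" for i j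
  have v: "v i \<in> H10 \<Omega>" for i
    using assms(1) by (simp add: H10_vec_def v_def)
  have bdd: "bounded (v i ` \<Omega>)" for i
    using bounded_component_cart[OF assms(2), of i] by (simp add: v_def image_image)
  have g: "g i j \<in> L2 \<Omega>" for i j
    unfolding g_def using L2_vec_nth[OF H10_L2(2)[OF v] \<Omega>] .
  have int: "integrable (lebesgue_on \<Omega>) (\<lambda>x. v k x * g i j x * v l x)" for i j k l
    using H10_L2(1)[OF v]
    by (intro L2_mult_integrable L2_mult_bounded[OF g L2_measurable bdd \<Omega>])
  have *: "2 * integral\<^sup>L (lebesgue_on \<Omega>) (\<lambda>x. v j x * g i j x * v i x)
      + integral\<^sup>L (lebesgue_on \<Omega>) (\<lambda>x. v i x * g j j x * v i x) = 0" for i j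
    using weak_product_rule[OF v[of i] v[of i] v[of j] bdd bdd assms(3,4), of j]
    by (simp add: g_def mult_ac)
  have "(sym_grad \<Omega> w x *v w x) \<bullet> w x
      = 1/2 * (\<Sum>i\<in>UNIV. \<Sum>j\<in>UNIV. v j x * g i j x * v i x)
        + 1/2 * (\<Sum>i\<in>UNIV. \<Sum>j\<in>UNIV. v j x * g j i x * v i x)" for x
    by (simp add: sym_grad_def Grad_def transpose_def matrix_vector_mult_def inner_vec_def g_def v_def
        sum_distrib_left sum_distrib_right sum.distrib algebra_simps flip: sum.distrib)
  \<comment> \<open>The transposed half of the symmetric gradient becomes the other half when the
    summation indices are exchanged.\<close>
  also have "\<dots> x = (\<Sum>i\<in>UNIV. \<Sum>j\<in>UNIV. v j x * g i j x * v i x)" for x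
    by (subst (2) sum.swap) (simp add: mult_ac)
  finally have 1: "ip \<Omega> (\<lambda>x. sym_grad \<Omega> w x *v w x) w
      = (\<Sum>i\<in>UNIV. \<Sum>j\<in>UNIV. integral\<^sup>L (lebesgue_on \<Omega>) (\<lambda>x. v j x * g i j x * v i x))"
    using int by (simp add: ip_def)
  have "(Div \<Omega> w x *\<^sub>R w x) \<bullet> w x = (\<Sum>i\<in>UNIV. \<Sum>j\<in>UNIV. v i x * g j j x * v i x)" for x
    by (simp add: Div_def trace_def Grad_def inner_vec_def g_def v_def
        sum_distrib_left sum_distrib_right mult_ac)
  then have 2: "ip \<Omega> (\<lambda>x. Div \<Omega> w x *\<^sub>R w x) w
      = (\<Sum>i\<in>UNIV. \<Sum>j\<in>UNIV. integral\<^sup>L (lebesgue_on \<Omega>) (\<lambda>x. v i x * g j j x * v i x))"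
    using int by (simp add: ip_def)
  show ?thesis
    unfolding emac_def 1 2 using * by (simp add: sum_distrib_left flip: sum.distrib)
qed

section \<open>The energy identity\<close>

lemma fin_span_comb:
  assumes "u \<in> fin_span m \<phi>" "v \<in> fin_span m \<phi>"
  shows "(\<lambda>x. s *\<^sub>R u x + t *\<^sub>R v x) \<in> fin_span m \<phi>"
proof -
  obtain c d where "u = (\<lambda>x. \<Sum>i<m. c i *\<^sub>R \<phi> i x)" "v = (\<lambda>x. \<Sum>i<m. d i *\<^sub>R \<phi> i x)"
    using assms unfolding fin_span_def by blast
  then have "(\<lambda>x. s *\<^sub>R u x + t *\<^sub>R v x) = (\<lambda>x. \<Sum>i<m. (s * c i + t * d i) *\<^sub>R \<phi> i x)"
    by (simp add: scaleR_sum_right algebra_simps sum.distrib)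
  then show ?thesis
    unfolding fin_span_def by (intro CollectI exI)
qed

lemma filt_in_fin_span:
  assumes "u n \<in> fin_span m \<phi>" "u (n - 1) \<in> fin_span m \<phi>" "u (n - 2) \<in> fin_span m \<phi>"
  shows "filt u n \<in> fin_span m \<phi>"
proof -
  \<comment> \<open>The trivial factor 1 brings the filter into the shape of two nested binary
    combinations.\<close>
  have "filt u n = (\<lambda>x. 1 *\<^sub>R ((3/2) *\<^sub>R u n x + (-1) *\<^sub>R u (n - 1) x) + (1/2) *\<^sub>R u (n - 2) x)"
    by (auto simp: filt_def)
  then show ?thesis
    using fin_span_comb[OF fin_span_comb[OF assms(1,2)] assms(3), of 1 "3/2" "-1" "1/2"] by simp
qed

text \<open>On each compact simplex \<open>v\<close> agrees with a continuous polynomial, and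
  finitely many cells cover the domain.\<close>

lemma fe_velocity_bounded:
  assumes "fe_velocity_space \<Omega> \<T> X" "regular_mesh \<Omega> \<sigma> h \<T>" "v \<in> X"
  shows "bounded (v ` \<Omega>)"
proof -
  have "bounded (v ` K)" if K: "K \<in> \<T>" for K
  proof -
    obtain p where p: "polynomial_function p" "\<And>x. x \<in> K \<Longrightarrow> v x = p x"
      using assms(1,3) K unfolding fe_velocity_space_def by metis
    have "int CARD('a) simplex K"
      using assms(2) K unfolding regular_mesh_def by simp
    then have "compact K"
      by (rule compact_simplex)
    then have "compact (p ` K)"
      using p(1) by (intro compact_continuous_image continuous_on_polymonial_function)
    then show ?thesis
      using p(2) by (simp add: compact_imp_bounded cong: image_cong)
  qed
  moreover have "finite \<T>" "\<Omega> \<subseteq> \<Union>\<T>"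
    using assms(2) closure_subset by (auto simp: regular_mesh_def triangulation_def)
  ultimately have "bounded (\<Union>K\<in>\<T>. v ` K)"
    by (intro bounded_UN) auto
  then show ?thesis
    by (rule bounded_subset) (use \<open>\<Omega> \<subseteq> \<Union>\<T>\<close> in blast)
qed

text \<open>This is the G-stability of the method. Both sides are the same quadratic form in
  \<open>a\<close>, \<open>b\<close>, \<open>c\<close>: the squares carry 9/4, 2, 1/4, and the
  products \<open>ab\<close>, \<open>ac\<close>, \<open>bc\<close> carry -9/2, 3/2, -3/2.\<close>

lemma G_norm_sq_identity:
  assumes "a \<in> L2 \<Omega>" "b \<in> L2 \<Omega>" "c \<in> L2 \<Omega>"
  shows "ip \<Omega> (\<lambda>x. (3/2) *\<^sub>R a x - 2 *\<^sub>R b x + (1/2) *\<^sub>R c x) (\<lambda>x. (3/2) *\<^sub>R a x - b x + (1/2) *\<^sub>R c x)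
    = G_norm_sq \<Omega> a b - G_norm_sq \<Omega> b c + 1/4 * F_norm_sq \<Omega> (\<lambda>x. a x - 2 *\<^sub>R b x + c x)"
proof -
  note L2_intros = assms L2_add L2_diff L2_scaleR
  have left: "ip \<Omega> (\<lambda>x. (3/2) *\<^sub>R a x - 2 *\<^sub>R b x + (1/2) *\<^sub>R c x) w
      = 3/2 * ip \<Omega> a w - 2 * ip \<Omega> b w + 1/2 * ip \<Omega> c w"
    "ip \<Omega> (\<lambda>x. a x - 2 *\<^sub>R b x + c x) w = ip \<Omega> a w - 2 * ip \<Omega> b w + ip \<Omega> c w"
    if "w \<in> L2 \<Omega>" for w
    using that by (simp_all add: ip_commute[of \<Omega> _ w] ip_add_right ip_diff_right ip_scaleR_right L2_intros)
  show ?thesis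
    by (simp add: left G_norm_sq_def F_norm_sq_def G_mat_def ip_add_right ip_diff_right ip_scaleR_right
        L2_intros ip_commute[of \<Omega> b a] ip_commute[of \<Omega> c a] ip_commute[of \<Omega> c b], simp add: field_simps)
qed

theorem theorem4p1:
  fixes \<Omega> :: "(real^'d) set"
    and \<T> :: "(real^'d) set set"
    and X\<^sub>h :: "((real^'d) \<Rightarrow> real^'d) set"
    and Q\<^sub>h :: "((real^'d) \<Rightarrow> real) set"
    and f :: "real \<Rightarrow> (real^'d) \<Rightarrow> real^'d"
    and u\<^sub>0 :: "(real^'d) \<Rightarrow> real^'d"
    and u :: "int \<Rightarrow> (real^'d) \<Rightarrow> real^'d"
    and P :: "int \<Rightarrow> (real^'d) \<Rightarrow> real"
    and \<phi> :: "nat \<Rightarrow> (real^'d) \<Rightarrow> real^'d"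
    and z a :: "nat \<Rightarrow> real^'d"
    and \<sigma> h \<beta>\<^sub>0 \<nu> T \<Delta>t :: real
    and N m :: nat
  assumes "CARD('d) \<in> {2, 3}"
    and "convex_polytopal_domain \<Omega>"
    and "regular_mesh \<Omega> \<sigma> h \<T>"
    and "fe_velocity_space \<Omega> \<T> X\<^sub>h"
    and "fe_pressure_space \<Omega> \<T> Q\<^sub>h"
    and "\<beta>\<^sub>0 > 0"
    and "discrete_inf_sup \<Omega> X\<^sub>h Q\<^sub>h \<beta>\<^sub>0"
    and "\<nu> \<ge> 0"
    and "T > 0"
    and "N \<ge> 1"
    and "\<Delta>t = T / real N"
    and "\<forall>n\<in>{1..N}. f (real n * \<Delta>t) \<in> L2 \<Omega>"
    and "nodal_basis \<Omega> X\<^sub>h m \<phi> z a"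
    and "u 0 = nodal_interpolant m \<phi> z a u\<^sub>0"
    and "u (- 1) = nodal_interpolant m \<phi> z a u\<^sub>0"
    and "emac_filtered_solution \<Omega> X\<^sub>h Q\<^sub>h \<nu> f \<Delta>t N u P"
  shows "G_norm_sq \<Omega> (u (int N)) (u (int N - 1))
           + \<Delta>t * (\<Sum>n=1..int N - 1. \<nu> * (L2norm \<Omega> (Grad \<Omega> (filt u (n + 1))))\<^sup>2)
           + 1/4 * (\<Sum>n=1..int N - 1. F_norm_sq \<Omega> (\<lambda>x. u (n + 1) x - 2 *\<^sub>R u n x + u (n - 1) x))
         = G_norm_sq \<Omega> (u 1) (u 0)
           + \<Delta>t * (\<Sum>n=1..int N - 1. ip \<Omega> (f (of_int (n + 1) * \<Delta>t)) (filt u (n + 1)))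
       \<and> (\<nu> = 0 \<and> (\<forall>t\<in>{0..T}. AE x in lebesgue_on \<Omega>. f t x = 0) \<longrightarrow>
           G_norm_sq \<Omega> (u (int N)) (u (int N - 1))
             + 1/4 * (\<Sum>n=1..int N - 1. F_norm_sq \<Omega> (\<lambda>x. u (n + 1) x - 2 *\<^sub>R u n x + u (n - 1) x))
           = G_norm_sq \<Omega> (u 1) (u 0))"
proof -
  have \<Omega>: "open \<Omega>" "bounded \<Omega>"
    using assms(2) polytope_imp_bounded[of "closure \<Omega>"] bounded_subset[OF _ closure_subset]
    unfolding convex_polytopal_domain_def by simp_all
  have X: "X\<^sub>h = fin_span m \<phi>" and XH10: "X\<^sub>h \<subseteq> H10_vec \<Omega>"
    using assms(4,13) by (auto simp: nodal_basis_def fe_velocity_space_def)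
  \<comment> \<open>The coefficients in the nodal basis are the degrees of freedom of the initial
    velocity. Both starting values thus lie in the velocity space.\<close>
  have "nodal_interpolant m \<phi> z a u\<^sub>0 \<in> X\<^sub>h"
    unfolding X fin_span_def nodal_interpolant_def[abs_def]
    by (intro CollectI exI[of _ "\<lambda>i. u\<^sub>0 (z i) \<bullet> a i"] refl)
  moreover have sol: "u (n + 1) \<in> X\<^sub>h" "P (n + 1) \<in> Q\<^sub>h"
    and scheme: "\<And>v q. v \<in> X\<^sub>h \<Longrightarrow> q \<in> Q\<^sub>h \<Longrightarrow>
          1 / \<Delta>t * ip \<Omega> (\<lambda>x. (3/2) *\<^sub>R u (n + 1) x - 2 *\<^sub>R u n x + (1/2) *\<^sub>R u (n - 1) x) v
            + \<nu> * ip \<Omega> (Grad \<Omega> (filt u (n + 1))) (Grad \<Omega> v)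
            + emac \<Omega> (filt u (n + 1)) (filt u (n + 1)) v
            - ip \<Omega> (P (n + 1)) (Div \<Omega> v)
          = ip \<Omega> (f (of_int (n + 1) * \<Delta>t)) v \<and>
          ip \<Omega> (Div \<Omega> (filt u (n + 1))) q = 0"
    if "n \<in> {0..int N - 1}" for n
    using assms(16) that unfolding emac_filtered_solution_def by blast+
  \<comment> \<open>The range begins at -1 because the filter in the step \<open>n = 0\<close>
    reaches back that far.\<close>
  ultimately have uX: "u n \<in> X\<^sub>h" if "-1 \<le> n" "n \<le> int N" for n
    using assms(14,15) sol(1)[of "n - 1"] that by (cases "n = -1 \<or> n = 0") auto
  have uL2: "u n \<in> L2 \<Omega>" if "-1 \<le> n" "n \<le> int N" for n
    using uX[OF that] XH10 H10_L2(1) by (intro L2_vecI) (auto simp: H10_vec_def)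
  have \<Delta>t: "\<Delta>t > 0"
    using assms by simp

  let ?D = "\<lambda>n. \<nu> * (L2norm \<Omega> (Grad \<Omega> (filt u (n + 1))))\<^sup>2"
  let ?S = "\<lambda>n. F_norm_sq \<Omega> (\<lambda>x. u (n + 1) x - 2 *\<^sub>R u n x + u (n - 1) x)"
  let ?W = "\<lambda>n. ip \<Omega> (f (of_int (n + 1) * \<Delta>t)) (filt u (n + 1))"
  have step: "G_norm_sq \<Omega> (u (n + 1)) (u n) + \<Delta>t * ?D n + 1/4 * ?S n
      = G_norm_sq \<Omega> (u n) (u (n - 1)) + \<Delta>t * ?W n" if n: "n \<in> {0..int N - 1}" for n
  proof -
    let ?w = "filt u (n + 1)"
    have w: "?w \<in> X\<^sub>h"
      unfolding X using n uX by (intro filt_in_fin_span) (auto simp: X)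
    then have "emac \<Omega> ?w ?w ?w = 0"
      using emac_self_eq_0 XH10 \<Omega> fe_velocity_bounded[OF assms(4,3)] by blast
    \<comment> \<open>The discrete pressure is itself an admissible \<open>q\<close> in the
      divergence constraint.\<close>
    moreover have "ip \<Omega> (P (n + 1)) (Div \<Omega> ?w) = 0"
      using scheme[OF n w sol(2)[OF n]] by (simp add: ip_commute)
    ultimately have "1 / \<Delta>t * ip \<Omega> (\<lambda>x. (3/2) *\<^sub>R u (n + 1) x - 2 *\<^sub>R u n x + (1/2) *\<^sub>R u (n - 1) x) ?w
        + ?D n = ?W n"
      using scheme[OF n w sol(2)[OF n]] by (simp add: L2norm_def ip_self_nonneg)
    moreover have "?w = (\<lambda>x. (3/2) *\<^sub>R u (n + 1) x - u n x + (1/2) *\<^sub>R u (n - 1) x)"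
      by (auto simp: filt_def)
    ultimately have "1 / \<Delta>t * (G_norm_sq \<Omega> (u (n + 1)) (u n) - G_norm_sq \<Omega> (u n) (u (n - 1)) + 1/4 * ?S n)
        + ?D n = ?W n"
      using G_norm_sq_identity[of "u (n + 1)" \<Omega> "u n" "u (n - 1)"] uL2 n by simp
    then show ?thesis
      using \<Delta>t by (simp add: field_simps)
  qed
  \<comment> \<open>Telescoping starts from the pair \<open>u 1\<close>, \<open>u 0\<close>, so for
    \<open>M = 0\<close> all sums are empty; \<open>M = N - 1\<close> gives the claim.\<close>
  have "G_norm_sq \<Omega> (u (int M + 1)) (u (int M)) + \<Delta>t * (\<Sum>n=1..int M. ?D n) + 1/4 * (\<Sum>n=1..int M. ?S n)
      = G_norm_sq \<Omega> (u 1) (u 0) + \<Delta>t * (\<Sum>n=1..int M. ?W n)" if "M < N" for M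
    using that
  proof (induction M)
    case (Suc M)
    have "{1..int (Suc M)} = insert (int M + 1) {1..int M}"
      by auto
    then show ?case
      using Suc step[of "int M + 1"] by (simp add: algebra_simps)
  qed simp
  from this[of "N - 1"] have "G_norm_sq \<Omega> (u (int N)) (u (int N - 1))
      + \<Delta>t * (\<Sum>n=1..int N - 1. ?D n) + 1/4 * (\<Sum>n=1..int N - 1. ?S n)
      = G_norm_sq \<Omega> (u 1) (u 0) + \<Delta>t * (\<Sum>n=1..int N - 1. ?W n)"
    using assms(10) by (simp add: of_nat_diff)
  moreover have "(\<Sum>n=1..int N - 1. ?W n) = 0"
    if f0: "\<forall>t\<in>{0..T}. AE x in lebesgue_on \<Omega>. f t x = 0"
  proof (intro sum.neutral ballI)
    fix n assume n: "n \<in> {1..int N - 1}"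
    then have "of_int (n + 1) * \<Delta>t \<le> real N * \<Delta>t"
      using \<Delta>t by (intro mult_right_mono) auto
    \<comment> \<open>Every sampling time lies in the interval where the force vanishes, since
      \<open>N\<close> steps of length \<open>\<Delta>t\<close> make up \<open>T\<close>.\<close>
    then have "of_int (n + 1) * \<Delta>t \<in> {0..T}"
      using assms(9-11) n by (auto intro!: divide_nonneg_nonneg mult_nonneg_nonneg)
    with f0 have "AE x in lebesgue_on \<Omega>. f (of_int (n + 1) * \<Delta>t) x = 0"
      by blast
    then have "AE x in lebesgue_on \<Omega>. f (of_int (n + 1) * \<Delta>t) x \<bullet> filt u (n + 1) x = 0"
      by eventually_elim simp
    then show "?W n = 0"
      unfolding ip_def by (rule integral_eq_zero_AE)
  qed
  ultimately show ?thesis by auto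
qed

end
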